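(* When $\alpha$ is a safe formula, the constrained LTLf specification $\mathcal{S}=\langle \mathcal{X}, \mathcal{Y}, \alpha, \varphi \rangle$ is realizable iff the LTLf specification $\mathcal{S}'=\langle \mathcal{X}, \mathcal{Y}, \alpha' \rightarrow \varphi \rangle$ is realizable, where $\alpha'$ is obtained from $\alpha$ by replacing every occurrence of $\mathsf{X}\psi$ (next) by $\mathsf{N}\psi$ (weak next).
   Context: Let $\mathcal{X}$ (uncontrollable) and $\mathcal{Y}$ (controllable) be disjoint finite sets of propositional variables. LTL formulas are interpreted over infinite traces; LTLf formulas have the same syntax but are interpreted over finite traces, where $\mathsf{X}\psi$ (strong next) holds at step $i$ only if a step $i+1$ exists and $\psi$ holds there, and weak next is the abbreviation $\mathsf{N}\psi := \mathsf{X}\psi \vee \neg\mathsf{X}\top$ (true also at the last step). The safe fragment of LTL is given by $\varphi ::= \top \mid \bot \mid p \mid \neg p \mid \varphi_1\wedge\varphi_2 \mid \varphi_1\vee\varphi_2 \mid \mathsf{X}\varphi \mid \varphi_1\,\mathcal{R}\,\varphi_2$ (negation only on atoms, release $\mathcal{R}$ instead of until); any infinite trace violating a safe formula has a finite bad prefix. An LTLf specification $\langle \mathcal{X}, \mathcal{Y}, \psi \rangle$ is realizable if there is a strategy $\sigma: (2^{\mathcal{X}})^* \rightarrow 2^{\mathcal{Y} \cup \{\mathsf{end}\}}$ that, for every infinite sequence $\mathbf{X}=X_1X_2\ldots$ of subsets of $\mathcal{X}$, outputs $\mathsf{end}$ at exactly one step $n$, with every induced finite trace $(X_1\cup\sigma(X_1))\cdots(X_n\cup\sigma(X_1\cdots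 X_n))$ (with $\mathsf{end}$ removed) satisfying $\psi$. A constrained LTLf specification $\langle \mathcal{X}, \mathcal{Y}, \alpha, \varphi \rangle$ has an LTLf objective $\varphi$ and an LTL assumption $\alpha$ (infinite semantics); strategies output $\mathsf{end}$ at most once per $\mathbf{X}$; a strategy is an $\alpha$-strategy if for every $\mathbf{X}$ either it outputs $\mathsf{end}$ at some finite step or the induced infinite trace $(X_1\cup\sigma(X_1))(X_2\cup\sigma(X_1X_2))\cdots$ violates $\alpha$; it is winning if it is an $\alpha$-strategy and every induced finite trace satisfies $\varphi$; realizable means a winning strategy exists. *)

theory Defs
  imports Main
begin

datatype (atoms: 'a) ltl =
    TT
  | FF
  | Atom 'a
  | Neg "'a ltl"
  | And "'a ltl" "'a ltl"
  | Or "'a ltl" "'a ltl"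
  | Next "'a ltl"
  | Until "'a ltl" "'a ltl"
  | Release "'a ltl" "'a ltl"

abbreviation Implies :: "'a ltl \<Rightarrow> 'a ltl \<Rightarrow> 'a ltl" where
  "Implies \<phi> \<psi> \<equiv> Or (Neg \<phi>) \<psi>"

abbreviation WNext :: "'a ltl \<Rightarrow> 'a ltl" where
  "WNext \<psi> \<equiv> Or (Next \<psi>) (Neg (Next TT))"

primrec ltl_holds :: "(nat \<Rightarrow> 'a set) \<Rightarrow> nat \<Rightarrow> 'a ltl \<Rightarrow> bool" where
  "ltl_holds w i TT \<longleftrightarrow> True"
| "ltl_holds w i FF \<longleftrightarrow> False"
| "ltl_holds w i (Atom p) \<longleftrightarrow> p \<in> w i"
| "ltl_holds w i (Neg \<phi>) \<longleftrightarrow> \<not> ltl_holds w i \<phi>"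
| "ltl_holds w i (And \<phi> \<psi>) \<longleftrightarrow> ltl_holds w i \<phi> \<and> ltl_holds w i \<psi>"
| "ltl_holds w i (Or \<phi> \<psi>) \<longleftrightarrow> ltl_holds w i \<phi> \<or> ltl_holds w i \<psi>"
| "ltl_holds w i (Next \<phi>) \<longleftrightarrow> ltl_holds w (Suc i) \<phi>"
| "ltl_holds w i (Until \<phi> \<psi>) \<longleftrightarrow>
     (\<exists>k\<ge>i. ltl_holds w k \<psi> \<and> (\<forall>j\<in>{i..<k}. ltl_holds w j \<phi>))"
| "ltl_holds w i (Release \<phi> \<psi>) \<longleftrightarrow>
     (\<forall>k\<ge>i. ltl_holds w k \<psi> \<or> (\<exists>j\<in>{i..<k}. ltl_holds w j \<phi>))"

text \<open>Finite-trace semantics, meaningful for positions below the length of the trace; such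
  positions are the only ones visited by the recursion.\<close>

primrec ltlf_holds :: "'a set list \<Rightarrow> nat \<Rightarrow> 'a ltl \<Rightarrow> bool" where
  "ltlf_holds w i TT \<longleftrightarrow> True"
| "ltlf_holds w i FF \<longleftrightarrow> False"
| "ltlf_holds w i (Atom p) \<longleftrightarrow> p \<in> w ! i"
| "ltlf_holds w i (Neg \<phi>) \<longleftrightarrow> \<not> ltlf_holds w i \<phi>"
| "ltlf_holds w i (And \<phi> \<psi>) \<longleftrightarrow> ltlf_holds w i \<phi> \<and> ltlf_holds w i \<psi>"
| "ltlf_holds w i (Or \<phi> \<psi>) \<longleftrightarrow> ltlf_holds w i \<phi> \<or> ltlf_holds w i \<psi>"
| "ltlf_holds w i (Next \<phi>) \<longleftrightarrow> Suc i < length w \<and> ltlf_holds w (Suc i) \<phi>"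
| "ltlf_holds w i (Until \<phi> \<psi>) \<longleftrightarrow>
     (\<exists>k\<in>{i..<length w}. ltlf_holds w k \<psi> \<and> (\<forall>j\<in>{i..<k}. ltlf_holds w j \<phi>))"
| "ltlf_holds w i (Release \<phi> \<psi>) \<longleftrightarrow>
     (\<forall>k\<in>{i..<length w}. ltlf_holds w k \<psi> \<or> (\<exists>j\<in>{i..<k}. ltlf_holds w j \<phi>))"

definition ltl_sat :: "(nat \<Rightarrow> 'a set) \<Rightarrow> 'a ltl \<Rightarrow> bool" where
  "ltl_sat w \<phi> \<longleftrightarrow> ltl_holds w 0 \<phi>"

definition ltlf_sat :: "'a set list \<Rightarrow> 'a ltl \<Rightarrow> bool" where
  "ltlf_sat w \<phi> \<longleftrightarrow> ltlf_holds w 0 \<phi>"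

inductive safe :: "'a ltl \<Rightarrow> bool" where
  "safe TT"
| "safe FF"
| "safe (Atom p)"
| "safe (Neg (Atom p))"
| "safe \<phi> \<Longrightarrow> safe \<psi> \<Longrightarrow> safe (And \<phi> \<psi>)"
| "safe \<phi> \<Longrightarrow> safe \<psi> \<Longrightarrow> safe (Or \<phi> \<psi>)"
| "safe \<phi> \<Longrightarrow> safe (Next \<phi>)"
| "safe \<phi> \<Longrightarrow> safe \<psi> \<Longrightarrow> safe (Release \<phi> \<psi>)"

primrec weaken_next :: "'a ltl \<Rightarrow> 'a ltl" where
  "weaken_next TT = TT"
| "weaken_next FF = FF"
| "weaken_next (Atom p) = Atom p"
| "weaken_next (Neg \<phi>) = Neg (weaken_next \<phi>)"
| "weaken_next (And \<phi> \<psi>) = And (weaken_next \<phi>) (weaken_next \<psi>)"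
| "weaken_next (Or \<phi> \<psi>) = Or (weaken_next \<phi>) (weaken_next \<psi>)"
| "weaken_next (Next \<phi>) = WNext (weaken_next \<phi>)"
| "weaken_next (Until \<phi> \<psi>) = Until (weaken_next \<phi>) (weaken_next \<psi>)"
| "weaken_next (Release \<phi> \<psi>) = Release (weaken_next \<phi>) (weaken_next \<psi>)"

text \<open>The set \<open>\<Y> \<union> {end}\<close>, with \<open>end\<close> a fresh symbol, is \<open>insert End (Ctrl ` \<Y>)\<close>.\<close>

datatype 'a out_symbol = Ctrl 'a | End

type_synonym 'a strategy = "'a set list \<Rightarrow> 'a out_symbol set"

definition strategy :: "'a set \<Rightarrow> 'a set \<Rightarrow> 'a strategy \<Rightarrow> bool" where
  "strategy \<X> \<Y> \<sigma> \<longleftrightarrow> (\<forall>u \<in> lists (Pow \<X>). \<sigma> u \<subseteq> insert End (Ctrl ` \<Y>))"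

definition input_seq :: "'a set \<Rightarrow> (nat \<Rightarrow> 'a set) \<Rightarrow> bool" where
  "input_seq \<X> \<xi> \<longleftrightarrow> (\<forall>i. \<xi> i \<subseteq> \<X>)"

text \<open>Steps are numbered from 0: the input of step \<open>i\<close> is \<open>\<xi> i\<close>, and the output at step \<open>i\<close> is
  given by the inputs of steps \<open>0, \<dots>, i\<close>. The output on the empty word is never used.\<close>

definition output_at :: "'a strategy \<Rightarrow> (nat \<Rightarrow> 'a set) \<Rightarrow> nat \<Rightarrow> 'a out_symbol set" where
  "output_at \<sigma> \<xi> i = \<sigma> (map \<xi> [0..<Suc i])"

definition ends_at :: "'a strategy \<Rightarrow> (nat \<Rightarrow> 'a set) \<Rightarrow> nat \<Rightarrow> bool" where
  "ends_at \<sigma> \<xi> n \<longleftrightarrow> End \<in> output_at \<sigma> \<xi> n"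

definition inf_trace :: "'a strategy \<Rightarrow> (nat \<Rightarrow> 'a set) \<Rightarrow> nat \<Rightarrow> 'a set" where
  "inf_trace \<sigma> \<xi> i = \<xi> i \<union> {y. Ctrl y \<in> output_at \<sigma> \<xi> i}"

definition fin_trace :: "'a strategy \<Rightarrow> (nat \<Rightarrow> 'a set) \<Rightarrow> nat \<Rightarrow> 'a set list" where
  "fin_trace \<sigma> \<xi> n = map (inf_trace \<sigma> \<xi>) [0..<Suc n]"

definition finite_traces_satisfy :: "'a set \<Rightarrow> 'a strategy \<Rightarrow> 'a ltl \<Rightarrow> bool" where
  "finite_traces_satisfy \<X> \<sigma> \<phi> \<longleftrightarrow>
     (\<forall>\<xi> n. input_seq \<X> \<xi> \<and> ends_at \<sigma> \<xi> n \<longrightarrow> ltlf_sat (fin_trace \<sigma> \<xi> n) \<phi>)"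

definition ltlf_realizable :: "'a set \<Rightarrow> 'a set \<Rightarrow> 'a ltl \<Rightarrow> bool" where
  "ltlf_realizable \<X> \<Y> \<psi> \<longleftrightarrow>
     (\<exists>\<sigma>. strategy \<X> \<Y> \<sigma> \<and>
          (\<forall>\<xi>. input_seq \<X> \<xi> \<longrightarrow> (\<exists>!n. ends_at \<sigma> \<xi> n)) \<and>
          finite_traces_satisfy \<X> \<sigma> \<psi>)"

definition constrained_strategy :: "'a set \<Rightarrow> 'a set \<Rightarrow> 'a strategy \<Rightarrow> bool" where
  "constrained_strategy \<X> \<Y> \<sigma> \<longleftrightarrow>
     strategy \<X> \<Y> \<sigma> \<and> (\<forall>\<xi>. input_seq \<X> \<xi> \<longrightarrow> (\<exists>\<^sub>\<le>\<^sub>1n. ends_at \<sigma> \<xi> n))"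

definition assumption_strategy :: "'a set \<Rightarrow> 'a set \<Rightarrow> 'a ltl \<Rightarrow> 'a strategy \<Rightarrow> bool" where
  "assumption_strategy \<X> \<Y> \<alpha> \<sigma> \<longleftrightarrow>
     constrained_strategy \<X> \<Y> \<sigma> \<and>
     (\<forall>\<xi>. input_seq \<X> \<xi> \<longrightarrow> (\<exists>n. ends_at \<sigma> \<xi> n) \<or> \<not> ltl_sat (inf_trace \<sigma> \<xi>) \<alpha>)"

definition constrained_winning :: "'a set \<Rightarrow> 'a set \<Rightarrow> 'a ltl \<Rightarrow> 'a ltl \<Rightarrow> 'a strategy \<Rightarrow> bool" where
  "constrained_winning \<X> \<Y> \<alpha> \<phi> \<sigma> \<longleftrightarrow>
     assumption_strategy \<X> \<Y> \<alpha> \<sigma> \<and> finite_traces_satisfy \<X> \<sigma> \<phi>"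

definition constrained_realizable :: "'a set \<Rightarrow> 'a set \<Rightarrow> 'a ltl \<Rightarrow> 'a ltl \<Rightarrow> bool" where
  "constrained_realizable \<X> \<Y> \<alpha> \<phi> \<longleftrightarrow> (\<exists>\<sigma>. constrained_winning \<X> \<Y> \<alpha> \<phi> \<sigma>)"

end

theory Submission
  imports Defs "HOL.Filter"
begin

text \<open>
  For safe \<open>\<alpha>\<close>, a prefix violating the weakened formula \<open>\<alpha>'\<close> is exactly a witness of a violation of
  \<open>\<alpha>\<close>: if an infinite trace satisfies \<open>\<alpha>\<close>, all its nonempty prefixes satisfy \<open>\<alpha>'\<close>, and if it
  violates \<open>\<alpha>\<close>, all its sufficiently long prefixes violate \<open>\<alpha>'\<close>. A constrained winning strategy
  therefore becomes an LTLf strategy by stopping also as soon as \<open>\<alpha>'\<close> is violated, and an LTLf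
  strategy becomes a constrained one by never stopping where it would stop without having
  achieved \<open>\<phi>\<close>, since there \<open>\<alpha>'\<close>, and hence \<open>\<alpha>\<close>, is already violated.
\<close>

text \<open>Truncation only removes obligations: a release ranges over fewer positions, and a weak
  next at the last position holds outright. Since negation occurs only on atoms, this monotonicity
  passes through the induction; \<open>i < n\<close> keeps the atom lookup inside the
  prefix.\<close>

lemma ltl_holds_imp_prefix_weaken_next:
  assumes "safe \<alpha>" and "ltl_holds w i \<alpha>" and "i < n"
  shows "ltlf_holds (map w [0..<n]) i (weaken_next \<alpha>)"
  using assms
proof (induction arbitrary: i rule: safe.induct)
  case (8 \<phi> \<psi>)
  have "ltlf_holds (map w [0..<n]) k (weaken_next \<psi>) \<or>
      (\<exists>j\<in>{i..<k}. ltlf_holds (map w [0..<n]) j (weaken_next \<phi>))" if k: "k \<in> {i..<n}" for k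
  proof -
    have "ltl_holds w k \<psi> \<or> (\<exists>j\<in>{i..<k}. ltl_holds w j \<phi>)"
      using "8.prems"(1) k by simp
    then show ?thesis
      using "8.IH" k by fastforce
  qed
  then show ?case
    by simp
qed auto

text \<open>A violation of a safe formula is witnessed by finitely many positions, and any prefix
  covering them exposes it. Mere existence of such a prefix would be too weak for the induction:
  disjunction and release need one prefix that refutes several subformulas at once.\<close>

lemma not_ltl_holds_imp_eventually_prefix_not_weaken_next:
  assumes "safe \<alpha>" and "\<not> ltl_holds w i \<alpha>"
  shows "\<forall>\<^sub>F n in sequentially. \<not> ltlf_holds (map w [0..<n]) i (weaken_next \<alpha>)"
  using assms
proof (induction arbitrary: i rule: safe.induct)
  case (3 p)
  show ?case
    using eventually_gt_at_top[of i] by eventually_elim (use 3 in simp)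
next
  case (4 p)
  show ?case
    using eventually_gt_at_top[of i] by eventually_elim (use 4 in simp)
next
  case (5 \<phi> \<psi>)
  then have "(\<forall>\<^sub>F n in sequentially. \<not> ltlf_holds (map w [0..<n]) i (weaken_next \<phi>)) \<or>
      (\<forall>\<^sub>F n in sequentially. \<not> ltlf_holds (map w [0..<n]) i (weaken_next \<psi>))"
    by auto
  then show ?case
    by (elim disjE) (auto elim: eventually_mono)
next
  case (6 \<phi> \<psi>)
  then show ?case
    by (simp add: eventually_conj)
next
  case (7 \<phi>)
  then have "\<forall>\<^sub>F n in sequentially. \<not> ltlf_holds (map w [0..<n]) (Suc i) (weaken_next \<phi>)"
    by simp
  \<comment> \<open>Beyond length \<open>Suc i\<close> the next position exists, so the weak next
    cannot hold by default.\<close>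
  then show ?case
    using eventually_gt_at_top[of "Suc i"] by eventually_elim simp
next
  case (8 \<phi> \<psi>)
  then obtain k where k: "k \<ge> i" "\<not> ltl_holds w k \<psi>" "\<forall>j\<in>{i..<k}. \<not> ltl_holds w j \<phi>"
    by auto
  have "\<forall>\<^sub>F n in sequentially. \<not> ltlf_holds (map w [0..<n]) k (weaken_next \<psi>)"
    using "8.IH" k by simp
  moreover have "\<forall>\<^sub>F n in sequentially.
      \<forall>j\<in>{i..<k}. \<not> ltlf_holds (map w [0..<n]) j (weaken_next \<phi>)"
    using "8.IH" k by (intro eventually_ball_finite) auto
  \<comment> \<open>The witness \<open>k\<close> must lie within the range of the finite-trace
    release.\<close>
  moreover have "\<forall>\<^sub>F n in sequentially. k < n"
    by (rule eventually_gt_at_top)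
  ultimately show ?case
    by eventually_elim (use k in auto)
qed auto

lemma not_ltl_sat_imp_fin_trace_not_weaken_next:
  assumes "safe \<alpha>" and "\<not> ltl_sat (inf_trace \<sigma> \<xi>) \<alpha>"
  shows "\<exists>n. \<not> ltlf_sat (fin_trace \<sigma> \<xi> n) (weaken_next \<alpha>)"
proof -
  have "\<forall>\<^sub>F n in sequentially.
      \<not> ltlf_holds (map (inf_trace \<sigma> \<xi>) [0..<n]) 0 (weaken_next \<alpha>)"
    using assms not_ltl_holds_imp_eventually_prefix_not_weaken_next
    unfolding ltl_sat_def by blast
  then obtain n where
    "\<not> ltlf_holds (map (inf_trace \<sigma> \<xi>) [0..<Suc n]) 0 (weaken_next \<alpha>)"
    unfolding eventually_sequentially using le_SucI by blast
  then show ?thesis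
    unfolding ltlf_sat_def fin_trace_def by blast
qed

lemma ltl_sat_imp_fin_trace_weaken_next:
  assumes "safe \<alpha>" and "ltl_sat (inf_trace \<sigma> \<xi>) \<alpha>"
  shows "ltlf_sat (fin_trace \<sigma> \<xi> n) (weaken_next \<alpha>)"
  using ltl_holds_imp_prefix_weaken_next[OF assms(1)] assms(2)
  unfolding ltl_sat_def ltlf_sat_def fin_trace_def by blast

text \<open>A strategy sees only the input word read so far, so a stopping rule that evaluates
  formulas must rebuild the trace from that word.\<close>

definition word_trace :: "'a strategy \<Rightarrow> 'a set list \<Rightarrow> 'a set list" where
  "word_trace \<sigma> u = map (\<lambda>i. u ! i \<union> {y. Ctrl y \<in> \<sigma> (take (Suc i) u)}) [0..<length u]"

lemma take_map_upt: "m \<le> n \<Longrightarrow> take m (map f [0..<n]) = map f [0..<m]"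
  by (simp add: take_map)

lemma word_trace_map_upt: "word_trace \<sigma> (map \<xi> [0..<Suc n]) = fin_trace \<sigma> \<xi> n"
  unfolding word_trace_def fin_trace_def inf_trace_def output_at_def
  by (rule nth_equalityI) (simp_all add: take_map_upt del: upt_Suc)

text \<open>Only \<open>End\<close> is altered, so the induced traces stay the same and both
  directions reduce to choosing \<open>P\<close>.\<close>

definition end_when :: "('a set list \<Rightarrow> bool) \<Rightarrow> 'a strategy \<Rightarrow> 'a strategy" where
  "end_when P \<sigma> u = (if P u then insert End (\<sigma> u) else \<sigma> u - {End})"

lemma ends_at_end_when: "ends_at (end_when P \<sigma>) \<xi> n \<longleftrightarrow> P (map \<xi> [0..<Suc n])"
  by (simp add: ends_at_def output_at_def end_when_def)

lemma inf_trace_end_when [simp]: "inf_trace (end_when P \<sigma>) = inf_trace \<sigma>"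
  by (simp add: fun_eq_iff inf_trace_def output_at_def end_when_def)

lemma fin_trace_end_when [simp]: "fin_trace (end_when P \<sigma>) = fin_trace \<sigma>"
  by (simp add: fun_eq_iff fin_trace_def)

lemma strategy_end_when: "strategy \<X> \<Y> \<sigma> \<Longrightarrow> strategy \<X> \<Y> (end_when P \<sigma>)"
  by (auto simp: strategy_def end_when_def)

lemma ltlf_realizable_if_constrained_realizable:
  assumes safe: "safe \<alpha>" and real: "constrained_realizable \<X> \<Y> \<alpha> \<phi>"
  shows "ltlf_realizable \<X> \<Y> (Implies (weaken_next \<alpha>) \<phi>)"
proof -
  obtain \<sigma> where strat: "strategy \<X> \<Y> \<sigma>"
    and ends: "\<And>\<xi>. input_seq \<X> \<xi> \<Longrightarrow>
      (\<exists>n. ends_at \<sigma> \<xi> n) \<or> \<not> ltl_sat (inf_trace \<sigma> \<xi>) \<alpha>"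
    and sat: "\<And>\<xi> n. input_seq \<X> \<xi> \<Longrightarrow> ends_at \<sigma> \<xi> n \<Longrightarrow> ltlf_sat (fin_trace \<sigma> \<xi> n) \<phi>"
    using real
    unfolding constrained_realizable_def constrained_winning_def assumption_strategy_def
      constrained_strategy_def finite_traces_satisfy_def by blast
  define stop where
    "stop u \<longleftrightarrow> End \<in> \<sigma> u \<or> \<not> ltlf_sat (word_trace \<sigma> u) (weaken_next \<alpha>)" for u
  \<comment> \<open>Stopping only at the first opportunity gives uniqueness. The bound
    \<open>0 < m\<close> skips the empty word, where the output has no meaning.\<close>
  define P where "P u \<longleftrightarrow> stop u \<and> (\<forall>m<length u. 0 < m \<longrightarrow> \<not> stop (take m u))" for u
  define S where "S \<xi> n \<longleftrightarrow> stop (map \<xi> [0..<Suc n])" for \<xi> n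
  have S_iff: "S \<xi> n \<longleftrightarrow>
      ends_at \<sigma> \<xi> n \<or> \<not> ltlf_sat (fin_trace \<sigma> \<xi> n) (weaken_next \<alpha>)" for \<xi> n
    unfolding S_def stop_def word_trace_map_upt ends_at_def output_at_def ..
  have P_iff: "ends_at (end_when P \<sigma>) \<xi> n \<longleftrightarrow> S \<xi> n \<and> (\<forall>m<n. \<not> S \<xi> m)" for \<xi> n
  proof -
    \<comment> \<open>Step \<open>m\<close> corresponds to the input prefix of length
      \<open>Suc m\<close>.\<close>
    have "(\<forall>m<Suc n. 0 < m \<longrightarrow> \<not> stop (map \<xi> [0..<m])) \<longleftrightarrow> (\<forall>m<n. \<not> S \<xi> m)"
      unfolding S_def by (metis Suc_less_eq gr0_implies_Suc zero_less_Suc)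
    then show ?thesis
      unfolding ends_at_end_when P_def S_def by (simp add: take_map_upt del: upt_Suc)
  qed
  have "\<exists>!n. ends_at (end_when P \<sigma>) \<xi> n" if "input_seq \<X> \<xi>" for \<xi>
  proof -
    have "\<exists>n. S \<xi> n"
      using ends[OF that] not_ltl_sat_imp_fin_trace_not_weaken_next[OF safe] S_iff by blast
    then have "\<exists>n. S \<xi> n \<and> (\<forall>m<n. \<not> S \<xi> m)"
      using exists_least_iff[of "S \<xi>"] by blast
    then show ?thesis
      unfolding P_iff by (metis linorder_neqE_nat)
  qed
  \<comment> \<open>At the stopping step either \<open>\<sigma>\<close> itself ends, which gives
    \<open>\<phi>\<close>, or the premise of the implication fails.\<close>
  moreover have
    "finite_traces_satisfy \<X> (end_when P \<sigma>) (Implies (weaken_next \<alpha>) \<phi>)"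
    unfolding finite_traces_satisfy_def P_iff S_iff
    using sat by (auto simp: ltlf_sat_def)
  ultimately show ?thesis
    unfolding ltlf_realizable_def using strategy_end_when[OF strat] by blast
qed

lemma constrained_realizable_if_ltlf_realizable:
  assumes safe: "safe \<alpha>" and real: "ltlf_realizable \<X> \<Y> (Implies (weaken_next \<alpha>) \<phi>)"
  shows "constrained_realizable \<X> \<Y> \<alpha> \<phi>"
proof -
  obtain \<sigma> where strat: "strategy \<X> \<Y> \<sigma>"
    and ends: "\<And>\<xi>. input_seq \<X> \<xi> \<Longrightarrow> \<exists>!n. ends_at \<sigma> \<xi> n"
    and sat: "\<And>\<xi> n. input_seq \<X> \<xi> \<Longrightarrow> ends_at \<sigma> \<xi> n \<Longrightarrow>
      ltlf_sat (fin_trace \<sigma> \<xi> n) (weaken_next \<alpha>) \<Longrightarrow> ltlf_sat (fin_trace \<sigma> \<xi> n) \<phi>"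
    using real
    unfolding ltlf_realizable_def finite_traces_satisfy_def ltlf_sat_def by auto
  define P where "P u \<longleftrightarrow> End \<in> \<sigma> u \<and> ltlf_sat (word_trace \<sigma> u) \<phi>" for u
  have P_iff: "ends_at (end_when P \<sigma>) \<xi> n \<longleftrightarrow>
      ends_at \<sigma> \<xi> n \<and> ltlf_sat (fin_trace \<sigma> \<xi> n) \<phi>" for \<xi> n
    unfolding ends_at_end_when P_def word_trace_map_upt
    unfolding ends_at_def output_at_def ..
  have "\<exists>\<^sub>\<le>\<^sub>1n. ends_at (end_when P \<sigma>) \<xi> n" if "input_seq \<X> \<xi>" for \<xi>
    unfolding P_iff Uniq_def using ends[OF that] by blast
  \<comment> \<open>If the end of \<open>\<sigma>\<close> was suppressed, \<open>\<phi>\<close>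
    fails there, hence so does the weakened assumption; a prefix of a trace satisfying
    \<open>\<alpha>\<close> cannot do that.\<close>
  moreover have "(\<exists>n. ends_at (end_when P \<sigma>) \<xi> n) \<or>
      \<not> ltl_sat (inf_trace (end_when P \<sigma>) \<xi>) \<alpha>" if "input_seq \<X> \<xi>" for \<xi>
    unfolding P_iff inf_trace_end_when
    using ends[OF that] sat[OF that] ltl_sat_imp_fin_trace_weaken_next[OF safe] by blast
  moreover have "finite_traces_satisfy \<X> (end_when P \<sigma>) \<phi>"
    unfolding finite_traces_satisfy_def P_iff by simp
  ultimately show ?thesis
    unfolding constrained_realizable_def constrained_winning_def assumption_strategy_def
      constrained_strategy_def
    using strategy_end_when[OF strat] by blast
qed

theorem theorem4:
  fixes \<X> \<Y> :: "'a set" and \<alpha> \<phi> :: "'a ltl"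
  assumes "finite \<X>" and "finite \<Y>" and "\<X> \<inter> \<Y> = {}"
    and "atoms \<alpha> \<subseteq> \<X> \<union> \<Y>" and "atoms \<phi> \<subseteq> \<X> \<union> \<Y>"
    and "safe \<alpha>"
  shows "constrained_realizable \<X> \<Y> \<alpha> \<phi> \<longleftrightarrow> ltlf_realizable \<X> \<Y> (Implies (weaken_next \<alpha>) \<phi>)"
  using ltlf_realizable_if_constrained_realizable[OF assms(6)]
    constrained_realizable_if_ltlf_realizable[OF assms(6)] by blast

end
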